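(* Suppose $m\in\omega$ and $0<\delta<\varepsilon<1$. There exists $n\in\omega$ such that for every finite set $I\subseteq\omega$ with $|I|>n$ there exists a set $C\subseteq 2^I$ such that $1-\varepsilon+\delta\geq |C|\cdot 2^{-|I|}\geq 1-\varepsilon-\delta$ and for every set $X\subseteq 2^I$ with $|X|\leq m$, $$\left|\frac{\left|\bigcap_{s\in X}(C+s)\right|}{2^{|I|}} - (1-\varepsilon)^{|X|}\right|<\delta.$$
   Context: For a finite set $I\subseteq\omega$, $2^I$ is the set of functions $I\to\{0,1\}$, a group under coordinatewise addition mod 2; $C+s=\{c+s:c\in C\}$. The empty intersection $\bigcap_{s\in\emptyset}(C+s)$ is understood as $2^I$. *)

theory Defs
  imports Complex_Main "HOL-Library.FuncSet" "HOL-Library.Z2"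
begin

text \<open>
  The values \<open>0, 1\<close> are taken in the two-element field \<^typ>\<open>bit\<close>, whose addition is
  addition mod 2. Functions with domain \<open>I\<close> are extensional: they take the value
  \<^term>\<open>undefined\<close> outside \<open>I\<close>.
\<close>

definition two_pow :: "nat set \<Rightarrow> (nat \<Rightarrow> bit) set" where
  "two_pow I = (I \<rightarrow>\<^sub>E UNIV)"

definition cadd :: "nat set \<Rightarrow> (nat \<Rightarrow> bit) \<Rightarrow> (nat \<Rightarrow> bit) \<Rightarrow> (nat \<Rightarrow> bit)" where
  "cadd I c s = (\<lambda>i\<in>I. c i + s i)"

definition translate :: "nat set \<Rightarrow> (nat \<Rightarrow> bit) set \<Rightarrow> (nat \<Rightarrow> bit) \<Rightarrow> (nat \<Rightarrow> bit) set" where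
  "translate I C s = {cadd I c s | c. c \<in> C}"

text \<open>
  Intersecting with \<^term>\<open>two_pow I\<close> only matters for \<open>X = {}\<close>, where it makes the empty
  intersection equal to \<^term>\<open>two_pow I\<close> rather than \<^term>\<open>UNIV\<close>.
\<close>

definition inter_translates ::
    "nat set \<Rightarrow> (nat \<Rightarrow> bit) set \<Rightarrow> (nat \<Rightarrow> bit) set \<Rightarrow> (nat \<Rightarrow> bit) set" where
  "inter_translates I C X = two_pow I \<inter> (\<Inter>s\<in>X. translate I C s)"

end

theory Submission
  imports Defs "HOL-Probability.Hoeffding" "HOL-Probability.Product_PMF" "HOL-Real_Asymp.Real_Asymp"
begin

text \<open>
  Let \<open>C\<close> contain each point of \<open>2\<^sup>I\<close> independently with probability \<open>p = 1 - \<epsilon>\<close>. A set \<open>X\<close> of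
  at most \<open>m\<close> points is separated by a set \<open>J \<subseteq> I\<close> of at most \<open>m\<^sup>2\<close> coordinates. If \<open>x\<close> and \<open>y\<close>
  are distinct but agree on \<open>J\<close>, then \<open>x + X\<close> and \<open>y + X\<close> are disjoint, so on each of the boundedly
  many classes of points with prescribed restriction to \<open>J\<close> the events \<open>x + X \<subseteq> C\<close> are
  independent, of probability \<open>p\<^bsup>|X|\<^esup>\<close>. Hoeffding's inequality makes the failure probability
  for \<open>X\<close> exponentially small in \<open>2\<^bsup>|I|\<^esup>\<close>, which beats the \<open>2\<^bsup>m|I|\<^esup>\<close> choices of \<open>X\<close>.
\<close>

section \<open>Concentration for events on disjoint blocks of random bits\<close>

text \<open>The indicators of \<open>\<forall>v\<in>B x. f v\<close> depend on disjoint blocks of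
  independent bits, so they are independent with mean \<open>p ^ k\<close>, and Hoeffding's
  inequality applies to their sum.\<close>

lemma Hoeffding_disjoint_blocks:
  fixes p t :: real and B :: "'b \<Rightarrow> 'a set"
  assumes V: "finite V" and A: "finite A" "A \<noteq> {}"
    and B: "\<And>x. x \<in> A \<Longrightarrow> B x \<subseteq> V" "\<And>x. x \<in> A \<Longrightarrow> card (B x) = k" "disjoint_family_on B A"
    and p: "0 \<le> p" "p \<le> 1" and t: "t \<ge> 0"
  shows "measure_pmf.prob (Pi_pmf V False (\<lambda>_. bernoulli_pmf p))
           {f. \<bar>real (card {x \<in> A. \<forall>v\<in>B x. f v}) - p ^ k * real (card A)\<bar> \<ge> t * real (card A)}
         \<le> 2 * exp (- 2 * t\<^sup>2 * real (card A))"
proof -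
  define P where "P = Pi_pmf V False (\<lambda>_. bernoulli_pmf p)"
  \<comment> \<open>As a product over the block, the indicator is a measurable function of the
    restriction of \<open>f\<close> to \<open>B x\<close>, so it inherits the independence of these
    restrictions.\<close>
  define X :: "'b \<Rightarrow> ('a \<Rightarrow> bool) \<Rightarrow> real" where "X = (\<lambda>x f. \<Prod>v\<in>B x. of_bool (f v))"
  have fB: "finite (B x)" if "x \<in> A" for x
    using B(1)[OF that] V finite_subset by blast
  have X_eq: "X x f = of_bool (\<forall>v\<in>B x. f v)" if "x \<in> A" for x f
    using fB[OF that] by (auto simp: X_def prod_zero_iff)
  have "prob_space.indep_vars (measure_pmf P) (\<lambda>_. count_space UNIV) (\<lambda>v f. f v) V"
    unfolding P_def by (rule indep_vars_Pi_pmf[OF V])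
  then have "prob_space.indep_vars (measure_pmf P) (\<lambda>x. PiM (B x) (\<lambda>_. count_space UNIV))
      (\<lambda>x f. restrict (\<lambda>v. f v) (B x)) A"
    using B by (intro prob_space.indep_vars_restrict[OF measure_pmf.prob_space_axioms]) auto
  then have "prob_space.indep_vars (measure_pmf P) (\<lambda>_. borel)
      (\<lambda>x f. (\<Prod>v\<in>B x. of_bool (restrict (\<lambda>v. f v) (B x) v) :: real)) A"
    by (rule prob_space.indep_vars_compose2[OF measure_pmf.prob_space_axioms]) measurable
  then have indep: "prob_space.indep_vars (measure_pmf P) (\<lambda>_. borel) X A"
    by (simp add: X_def cong: prod.cong)
  interpret Hoeffding_ineq "measure_pmf P" A X "\<lambda>_. 0" "\<lambda>_. 1"
      "\<Sum>x\<in>A. measure_pmf.expectation P (X x)"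
    by unfold_locales (use A indep in \<open>auto simp: X_eq\<close>)
  have E: "measure_pmf.expectation P (X x) = p ^ k" if "x \<in> A" for x
  proof -
    have "measure_pmf.expectation P (X x) = measure_pmf.expectation P (indicator (Pi V (\<lambda>v. if v \<in> B x then {True} else UNIV)))"
      using B(1)[OF that] by (intro Bochner_Integration.integral_cong)
        (auto simp: X_eq that indicator_def Pi_def)
    also have "\<dots> = (\<Prod>v\<in>V. measure_pmf.prob (bernoulli_pmf p) (if v \<in> B x then {True} else UNIV))"
      by (simp add: P_def measure_Pi_pmf_Pi V)
    also have "\<dots> = (\<Prod>v\<in>V. if v \<in> B x then p else 1)"
      using p by (intro prod.cong) (auto simp: measure_pmf_single)
    also have "\<dots> = p ^ card (B x)"
      using B(1)[OF that] V by (simp add: prod.If_cases Int_absorb1)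
    finally show ?thesis using B(2)[OF that] by simp
  qed
  have S: "(\<Sum>x\<in>A. X x f) = real (card {x \<in> A. \<forall>v\<in>B x. f v})" for f
    using A by (simp add: X_eq sum.If_cases Int_def of_bool_def)
  have "card A > 0" using A by (simp add: card_gt_0_iff)
  then show ?thesis
    using Hoeffding_ineq_abs_ge[of "t * real (card A)"] t E
    by (simp add: S P_def[symmetric] power2_eq_square mult_ac)
qed

section \<open>Arithmetic of the group \<open>two_pow I\<close> and its translates\<close>

lemma cadd_in_two_pow: "cadd I x s \<in> two_pow I"
  by (auto simp: two_pow_def cadd_def)

lemma UNIV_bit: "(UNIV :: bit set) = {0, 1}"
proof -
  have "x \<in> {0, 1}" for x :: bit by (cases x) auto
  then show ?thesis by blast
qed

lemma finite_two_pow: "finite I \<Longrightarrow> finite (two_pow I)"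
  by (simp add: two_pow_def finite_PiE UNIV_bit)

lemma card_two_pow: "finite I \<Longrightarrow> card (two_pow I) = 2 ^ card I"
  by (simp add: two_pow_def card_PiE UNIV_bit numeral_2_eq_2)

lemma two_pow_eqI:
  "x \<in> two_pow I \<Longrightarrow> y \<in> two_pow I \<Longrightarrow> (\<And>i. i \<in> I \<Longrightarrow> x i = y i) \<Longrightarrow> x = y"
  unfolding two_pow_def by (rule PiE_ext)

lemma cadd_eq_iff: "cadd I x s = cadd I y t \<longleftrightarrow> (\<forall>i\<in>I. x i + s i = y i + t i)"
proof
  assume eq: "cadd I x s = cadd I y t"
  show "\<forall>i\<in>I. x i + s i = y i + t i"
  proof
    fix i assume "i \<in> I"
    then show "x i + s i = y i + t i"
      using fun_cong[OF eq, of i] by (simp only: cadd_def restrict_apply' if_True)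
  qed
next
  assume "\<forall>i\<in>I. x i + s i = y i + t i"
  then show "cadd I x s = cadd I y t"
    unfolding cadd_def by (intro restrict_ext) blast
qed

lemma cadd_cancel: "cadd I x s = cadd I y s \<longleftrightarrow> (\<forall>i\<in>I. x i = y i)"
  by (simp only: cadd_eq_iff add_right_cancel)

lemma cadd_left_cancel: "cadd I x s = cadd I x t \<longleftrightarrow> (\<forall>i\<in>I. s i = t i)"
  by (simp only: cadd_eq_iff add_left_cancel)

lemma cadd_cadd: "x \<in> two_pow I \<Longrightarrow> cadd I (cadd I x s) s = x"
  by (rule two_pow_eqI[where I = I]) (auto simp: cadd_def two_pow_def add.assoc)

text \<open>Every element is its own inverse, so undoing the translation by \<open>s\<close> means
  adding \<open>s\<close> again.\<close>

lemma mem_translate_iff: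
  assumes "C \<subseteq> two_pow I" "x \<in> two_pow I"
  shows "x \<in> translate I C s \<longleftrightarrow> cadd I x s \<in> C"
  using assms by (auto simp: translate_def cadd_cadd) (metis cadd_cadd)

lemma inter_translates_eq:
  assumes "C \<subseteq> two_pow I"
  shows "inter_translates I C X = {x \<in> two_pow I. \<forall>s\<in>X. cadd I x s \<in> C}"
  using assms by (auto simp: inter_translates_def mem_translate_iff)

section \<open>Separating coordinates and the classes they define\<close>

text \<open>For each ordered pair of distinct elements of \<open>X\<close>, pick one coordinate
  where they differ.\<close>

lemma ex_separating_coordinates:
  assumes "finite X" "X \<subseteq> two_pow I"
  shows "\<exists>J \<subseteq> I. finite J \<and> card J \<le> card X * card X \<and>
    (\<forall>s\<in>X. \<forall>t\<in>X. (\<forall>i\<in>J. s i = t i) \<longrightarrow> s = t)"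
proof -
  define D where "D = {(s, t) \<in> X \<times> X. s \<noteq> t}"
  have "\<exists>i\<in>I. fst d i \<noteq> snd d i" if "d \<in> D" for d
  proof -
    have "fst d \<in> two_pow I" "snd d \<in> two_pow I" "fst d \<noteq> snd d"
      using that assms(2) by (auto simp: D_def)
    then show ?thesis using two_pow_eqI by blast
  qed
  then obtain h where h: "\<And>d. d \<in> D \<Longrightarrow> h d \<in> I \<and> fst d (h d) \<noteq> snd d (h d)"
    by metis
  have D: "D \<subseteq> X \<times> X" by (auto simp: D_def)
  then have fD: "finite D" using assms finite_subset by blast
  have "card (h ` D) \<le> card D" using fD by (rule card_image_le)
  also have "\<dots> \<le> card X * card X"
    using card_mono[OF _ D] assms by (simp add: card_cartesian_product)
  finally have "card (h ` D) \<le> card X * card X" .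
  moreover have "s = t" if "s \<in> X" "t \<in> X" "\<forall>i\<in>h ` D. s i = t i" for s t
    using h[of "(s, t)"] that by (force simp: D_def)
  ultimately show ?thesis
    using h fD by (intro exI[of _ "h ` D"]) auto
qed

text \<open>The values on \<open>I - J\<close> are free. That all classes have the same size lets
  their deviations add up to a multiple of \<open>2 ^ card I\<close>.\<close>

lemma card_two_pow_fixed_restriction:
  assumes "finite I" "J \<subseteq> I" "a \<in> two_pow J"
  shows "card {x \<in> two_pow I. restrict x J = a} = 2 ^ (card I - card J)"
proof -
  have "bij_betw (\<lambda>y. \<lambda>i\<in>I. if i \<in> J then a i else y i)
      (two_pow (I - J)) {x \<in> two_pow I. restrict x J = a}"
    by (rule bij_betw_byWitness[where f' = "\<lambda>x. restrict x (I - J)"])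
      (use assms in \<open>auto simp: two_pow_def PiE_def extensional_def fun_eq_iff restrict_def\<close>)
  then have "card (two_pow (I - J)) = card {x \<in> two_pow I. restrict x J = a}"
    by (rule bij_betw_same_card)
  moreover have "card (I - J) = card I - card J"
    using assms finite_subset by (intro card_Diff_subset) auto
  ultimately show ?thesis using assms by (simp add: card_two_pow)
qed

section \<open>Failure probability for a single \<open>X\<close>\<close>

text \<open>A deviation over the whole of \<open>two_pow I\<close> forces one in some class of
  points with a common restriction to \<open>J\<close>. There are at most \<open>2 ^ (m * m)\<close>
  classes, and Hoeffding's bound holds in each.\<close>

lemma prob_translate_count_deviates:
  fixes p \<delta> :: real
  assumes I: "finite I" and X: "X \<subseteq> two_pow I" "card X \<le> m" and m: "m * m \<le> card I"
    and p: "0 \<le> p" "p \<le> 1" and \<delta>: "\<delta> > 0"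
  shows "measure_pmf.prob (Pi_pmf (two_pow I) False (\<lambda>_. bernoulli_pmf p))
      {f. \<bar>real (card {x \<in> two_pow I. \<forall>s\<in>X. f (cadd I x s)}) - p ^ card X * 2 ^ card I\<bar>
            \<ge> \<delta> * 2 ^ card I}
    \<le> 2 ^ (m * m) * (2 * exp (- 2 * \<delta>\<^sup>2 * 2 ^ (card I - m * m)))"
    (is "measure_pmf.prob ?P ?bad \<le> _")
proof -
  have fV: "finite (two_pow I)" by (rule finite_two_pow[OF I])
  then have fX: "finite X" using X finite_subset by blast
  obtain J where J: "J \<subseteq> I" "finite J" "card J \<le> card X * card X"
    and sep: "\<And>s t. s \<in> X \<Longrightarrow> t \<in> X \<Longrightarrow> (\<And>i. i \<in> J \<Longrightarrow> s i = t i) \<Longrightarrow> s = t"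
    using ex_separating_coordinates[OF fX X(1)] by metis
  have cJ: "card J \<le> m * m"
    using J(3) mult_le_mono[OF X(2) X(2)] by linarith
  have cardIJ: "(2::real) ^ card J * 2 ^ (card I - card J) = 2 ^ card I"
    using cJ m by (simp flip: power_add)
  define A where "A = (\<lambda>a. {x \<in> two_pow I. restrict x J = a})"
  have cA: "card (A a) = 2 ^ (card I - card J)" if "a \<in> two_pow J" for a
    unfolding A_def by (rule card_two_pow_fixed_restriction[OF I J(1) that])
  have fA: "finite (A a)" for a using fV by (simp add: A_def)
  define good where "good = (\<lambda>f a. {x \<in> A a. \<forall>v\<in>cadd I x ` X. f v})"
  define bad where "bad = (\<lambda>a. {f. \<bar>real (card (good f a)) - p ^ card X * real (card (A a))\<bar>
    \<ge> \<delta> * real (card (A a))})"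
  have bad_le: "measure_pmf.prob ?P (bad a) \<le> 2 * exp (- 2 * \<delta>\<^sup>2 * 2 ^ (card I - m * m))"
    if a: "a \<in> two_pow J" for a
  proof -
    have "A a \<noteq> {}" using cA[OF a] by (metis card.empty power_not_zero zero_neq_numeral)
    moreover have "card (cadd I x ` X) = card X" for x
      using X(1) by (intro card_image inj_onI) (meson cadd_left_cancel subsetD two_pow_eqI)
    \<comment> \<open>If \<open>x\<close> and \<open>y\<close> agree on \<open>J\<close>, then
      \<open>x + s = y + t\<close> makes \<open>s\<close> and \<open>t\<close> agree on
      \<open>J\<close>. Separation gives \<open>s = t\<close>, and cancelling gives
      \<open>x = y\<close>.\<close>
    moreover have "disjoint_family_on (\<lambda>x. cadd I x ` X) (A a)"
    proof -
      have "x = y" if xy: "x \<in> A a" "y \<in> A a" and st: "s \<in> X" "t \<in> X"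
        and eq: "cadd I x s = cadd I y t" for x y s t
      proof -
        have "s i = t i" if "i \<in> J" for i
        proof -
          have "x i = y i" using xy that unfolding A_def by (metis (mono_tags, lifting) mem_Collect_eq restrict_apply')
          moreover have "x i + s i = y i + t i"
            using fun_cong[OF eq, of i] that J(1) by (auto simp: cadd_def)
          ultimately show ?thesis by (metis add_left_cancel)
        qed
        then have "s = t" using sep st by blast
        then show ?thesis using eq xy two_pow_eqI by (auto simp: cadd_cancel A_def)
      qed
      then show ?thesis by (fastforce simp: disjoint_family_on_def)
    qed
    ultimately have "measure_pmf.prob ?P (bad a) \<le> 2 * exp (- 2 * \<delta>\<^sup>2 * real (card (A a)))"
      unfolding bad_def good_def
      by (intro Hoeffding_disjoint_blocks) (use fV fA p \<delta> cadd_in_two_pow in auto)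
    \<comment> \<open>A class has at least \<open>2 ^ (card I - m * m)\<close> points because
      \<open>card J \<le> m * m\<close>.\<close>
    also have "\<dots> \<le> 2 * exp (- 2 * \<delta>\<^sup>2 * 2 ^ (card I - m * m))"
      using cJ by (simp add: cA[OF a] mult_left_mono power_increasing)
    finally show ?thesis .
  qed
  have part: "card {x \<in> two_pow I. \<forall>s\<in>X. f (cadd I x s)} = (\<Sum>a\<in>two_pow J. card (good f a))" for f
  proof -
    have "{x \<in> two_pow I. \<forall>s\<in>X. f (cadd I x s)} = (\<Union>a\<in>two_pow J. good f a)"
      by (auto simp: good_def A_def two_pow_def)
    also have "card \<dots> = (\<Sum>a\<in>two_pow J. card (good f a))"
      using fA fV J(2) by (intro card_UN_disjoint) (auto simp: good_def A_def finite_two_pow)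
    finally show ?thesis .
  qed
  have "?bad \<subseteq> (\<Union>a\<in>two_pow J. bad a)"
  proof (rule subsetI, rule ccontr)
    fix f assume f: "f \<in> ?bad" and nf: "f \<notin> (\<Union>a\<in>two_pow J. bad a)"
    let ?d = "\<lambda>a. real (card (good f a)) - p ^ card X * 2 ^ (card I - card J)"
    have "real (card {x \<in> two_pow I. \<forall>s\<in>X. f (cadd I x s)}) - p ^ card X * 2 ^ card I
        = (\<Sum>a\<in>two_pow J. ?d a)"
      using cardIJ J(2) by (simp add: part sum_subtractf card_two_pow mult_ac)
    also have "\<bar>\<dots>\<bar> \<le> (\<Sum>a\<in>two_pow J. \<bar>?d a\<bar>)" by (rule sum_abs)
    \<comment> \<open>Strictness needs a nonempty index set, which the cardinality of
      \<open>two_pow J\<close> provides.\<close>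
    also have "\<dots> < (\<Sum>a\<in>two_pow J. \<delta> * 2 ^ (card I - card J))"
      using nf J(2) card_two_pow[OF J(2)]
      by (intro sum_strict_mono finite_two_pow) (auto simp: bad_def cA not_le)
    also have "\<dots> = \<delta> * 2 ^ card I"
      using cardIJ J(2) by (simp add: card_two_pow mult_ac)
    finally show False using f by simp
  qed
  then have "measure_pmf.prob ?P ?bad \<le> measure_pmf.prob ?P (\<Union>a\<in>two_pow J. bad a)"
    by (intro measure_pmf.finite_measure_mono) auto
  also have "\<dots> \<le> (\<Sum>a\<in>two_pow J. measure_pmf.prob ?P (bad a))"
    using J(2) by (intro measure_pmf.finite_measure_subadditive_finite) (auto simp: finite_two_pow)
  also have "\<dots> \<le> real (card (two_pow J)) * (2 * exp (- 2 * \<delta>\<^sup>2 * 2 ^ (card I - m * m)))"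
    using bad_le by (rule sum_bounded_above)
  also have "\<dots> \<le> 2 ^ (m * m) * (2 * exp (- 2 * \<delta>\<^sup>2 * 2 ^ (card I - m * m)))"
    using J(2) cJ by (intro mult_right_mono) (auto simp: card_two_pow power_increasing)
  finally show ?thesis .
qed

section \<open>Union bound over all \<open>X\<close>\<close>

text \<open>Enumerate \<open>X\<close> and pad with copies of one of its elements to a list of
  length exactly \<open>m\<close>; there are \<open>card V ^ m\<close> such lists. Padding is why
  \<open>X\<close> must be nonempty.\<close>

lemma card_nonempty_subsets_le:
  assumes "finite V"
  shows "finite {X. X \<subseteq> V \<and> X \<noteq> {} \<and> card X \<le> m}"
    and "card {X. X \<subseteq> V \<and> X \<noteq> {} \<and> card X \<le> m} \<le> card V ^ m"
proof -
  let ?L = "{xs. set xs \<subseteq> V \<and> length xs = m}"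
  have "X \<in> set ` ?L" if X: "X \<subseteq> V" "X \<noteq> {}" "card X \<le> m" for X
  proof -
    obtain xs where xs: "set xs = X" "distinct xs"
      using X(1) assms finite_distinct_list finite_subset by metis
    then have "length xs = card X" by (metis distinct_card)
    obtain v where "v \<in> X" using X(2) by auto
    have "set (xs @ replicate (m - card X) v) = X"
      using xs \<open>v \<in> X\<close> by (auto simp: set_replicate_conv_if)
    then show ?thesis
      using X \<open>length xs = card X\<close>
      by (intro image_eqI[of _ _ "xs @ replicate (m - card X) v"]) auto
  qed
  then have sub: "{X. X \<subseteq> V \<and> X \<noteq> {} \<and> card X \<le> m} \<subseteq> set ` ?L" by blast
  have fL: "finite ?L" by (rule finite_lists_length_eq[OF assms])
  show "finite {X. X \<subseteq> V \<and> X \<noteq> {} \<and> card X \<le> m}"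
    by (rule finite_subset[OF sub finite_imageI[OF fL]])
  have "card {X. X \<subseteq> V \<and> X \<noteq> {} \<and> card X \<le> m} \<le> card ?L"
    by (rule order_trans[OF card_mono[OF finite_imageI[OF fL] sub] card_image_le[OF fL]])
  then show "card {X. X \<subseteq> V \<and> X \<noteq> {} \<and> card X \<le> m} \<le> card V ^ m"
    by (simp add: card_lists_length_eq[OF assms])
qed

lemma ex_set_with_uniform_translate_counts:
  fixes p \<delta> :: real
  assumes p: "0 \<le> p" "p \<le> 1" and \<delta>: "\<delta> > 0"
  shows "\<exists>n. \<forall>I. finite I \<and> card I > n \<longrightarrow> (\<exists>C \<subseteq> two_pow I. \<forall>X \<subseteq> two_pow I. card X \<le> m \<longrightarrow>
    \<bar>real (card (inter_translates I C X)) / 2 ^ card I - p ^ card X\<bar> < \<delta>)"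
proof -
  \<comment> \<open>Chosen so that the exponent in the failure bound becomes
    \<open>- c * 2 ^ card I\<close>.\<close>
  define c where "c = 2 * \<delta>\<^sup>2 / 2 ^ (m * m)"
  have c: "c > 0" using \<delta> by (simp add: c_def)
  \<comment> \<open>Here \<open>x\<close> stands for \<open>2 ^ card I\<close>: the factor
    \<open>x ^ m\<close> counts the sets \<open>X\<close>, and the rest bounds the failure
    probability of each.\<close>
  have "((\<lambda>x. x ^ m * (2 ^ (m * m) * (2 * exp (- c * x)))) \<longlongrightarrow> 0) at_top"
    using c by real_asymp
  moreover have "filterlim (\<lambda>n. (2::real) ^ n) at_top sequentially" by real_asymp
  ultimately have "((\<lambda>n. ((2::real) ^ n) ^ m * (2 ^ (m * m) * (2 * exp (- c * 2 ^ n)))) \<longlongrightarrow> 0) sequentially"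
    by (rule filterlim_compose)
  then have "eventually (\<lambda>n. ((2::real) ^ n) ^ m * (2 ^ (m * m) * (2 * exp (- c * 2 ^ n))) < 1) sequentially"
    by (rule order_tendstoD) simp
  then obtain n0 where n0: "\<And>n. n \<ge> n0 \<Longrightarrow>
      ((2::real) ^ n) ^ m * (2 ^ (m * m) * (2 * exp (- c * 2 ^ n))) < 1"
    by (auto simp: eventually_sequentially)
  have "\<exists>C \<subseteq> two_pow I. \<forall>X \<subseteq> two_pow I. card X \<le> m \<longrightarrow>
      \<bar>real (card (inter_translates I C X)) / 2 ^ card I - p ^ card X\<bar> < \<delta>"
    \<comment> \<open>\<open>n0\<close> brings the union bound below 1; \<open>m * m\<close> meets
      the hypothesis of the single-set bound and makes the truncated subtraction in the exponent
      exact.\<close>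
    if I: "finite I" and n: "card I > max n0 (m * m)" for I
  proof -
    define P where "P = Pi_pmf (two_pow I) False (\<lambda>_. bernoulli_pmf p)"
    define F where "F = {X. X \<subseteq> two_pow I \<and> X \<noteq> {} \<and> card X \<le> m}"
    define bad where "bad = (\<lambda>X. {f.
      \<bar>real (card {x \<in> two_pow I. \<forall>s\<in>X. f (cadd I x s)}) - p ^ card X * 2 ^ card I\<bar>
            \<ge> \<delta> * 2 ^ card I})"
    have fF: "finite F" and cF: "card F \<le> (2 ^ card I) ^ m"
      using card_nonempty_subsets_le[OF finite_two_pow[OF I], of m] I
      by (simp_all add: F_def card_two_pow)
    have exp_eq: "- 2 * \<delta>\<^sup>2 * 2 ^ (card I - m * m) = - c * 2 ^ card I"
      using n by (simp add: c_def power_diff)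
    have "measure_pmf.prob P (\<Union>X\<in>F. bad X) \<le> (\<Sum>X\<in>F. measure_pmf.prob P (bad X))"
      using fF by (intro measure_pmf.finite_measure_subadditive_finite) auto
    also have "\<dots> \<le> real (card F) * (2 ^ (m * m) * (2 * exp (- c * 2 ^ card I)))"
      unfolding P_def bad_def
      by (intro sum_bounded_above order_trans[OF prob_translate_count_deviates[OF I _ _ _ p \<delta>, of _ m]])
        (use n exp_eq in \<open>auto simp: F_def\<close>)
    also have "\<dots> \<le> (2 ^ card I) ^ m * (2 ^ (m * m) * (2 * exp (- c * 2 ^ card I)))"
    proof (rule mult_right_mono)
      show "real (card F) \<le> (2 ^ card I) ^ m"
        using of_nat_mono[OF cF, where 'a = real] by simp
    qed simp
    also have "\<dots> < 1" using n by (intro n0) auto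
    \<comment> \<open>The whole space has probability 1, so some outcome \<open>f\<close> avoids
      every bad event.\<close>
    finally have "(\<Union>X\<in>F. bad X) \<noteq> UNIV"
      by (metis less_irrefl measure_pmf.prob_space space_measure_pmf)
    then obtain f where f: "\<And>X. X \<in> F \<Longrightarrow> f \<notin> bad X" by blast
    define C where "C = {v \<in> two_pow I. f v}"
    have C: "C \<subseteq> two_pow I" by (auto simp: C_def)
    have "\<bar>real (card (inter_translates I C X)) / 2 ^ card I - p ^ card X\<bar> < \<delta>"
      if X: "X \<subseteq> two_pow I" "card X \<le> m" for X
    \<comment> \<open>The empty set lies outside \<open>F\<close>; for it the ratio and the power
      both equal 1.\<close>
    proof (cases "X = {}")
      case True
      then show ?thesis using \<delta> I by (simp add: inter_translates_def card_two_pow)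
    next
      case False
      have eq: "inter_translates I C X = {x \<in> two_pow I. \<forall>s\<in>X. f (cadd I x s)}"
        unfolding inter_translates_eq[OF C] by (simp add: C_def cadd_in_two_pow)
      have "\<bar>real (card (inter_translates I C X)) - p ^ card X * 2 ^ card I\<bar> < \<delta> * 2 ^ card I"
        using f[of X] False X by (simp add: F_def bad_def eq)
      then have "\<bar>(real (card (inter_translates I C X)) - p ^ card X * 2 ^ card I) / 2 ^ card I\<bar> < \<delta>"
        by (simp add: abs_divide divide_less_eq)
      then show ?thesis by (simp add: diff_divide_distrib)
    qed
    with C show ?thesis by blast
  qed
  then show ?thesis by blast
qed

section \<open>Density of \<open>C\<close> from the one-point case\<close>

theorem theorem3p3:
  fixes m :: nat and \<delta> \<epsilon> :: real
  assumes "0 < \<delta>" and "\<delta> < \<epsilon>" and "\<epsilon> < 1"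
  shows "\<exists>n::nat. \<forall>I::nat set. finite I \<and> card I > n \<longrightarrow>
    (\<exists>C \<subseteq> two_pow I.
       1 - \<epsilon> + \<delta> \<ge> real (card C) * 2 powi (- int (card I)) \<and>
       real (card C) * 2 powi (- int (card I)) \<ge> 1 - \<epsilon> - \<delta> \<and>
       (\<forall>X \<subseteq> two_pow I. card X \<le> m \<longrightarrow>
          \<bar>real (card (inter_translates I C X)) / 2 ^ card I - (1 - \<epsilon>) ^ card X\<bar> < \<delta>))"
proof -
  \<comment> \<open>\<open>Suc m\<close> instead of \<open>m\<close> ensures that singletons are
    covered even if \<open>m = 0\<close>.\<close>
  obtain n where n: "\<And>I. finite I \<Longrightarrow> card I > n \<Longrightarrow> \<exists>C \<subseteq> two_pow I. \<forall>X \<subseteq> two_pow I. card X \<le> Suc m \<longrightarrow>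
    \<bar>real (card (inter_translates I C X)) / 2 ^ card I - (1 - \<epsilon>) ^ card X\<bar> < \<delta>"
    using ex_set_with_uniform_translate_counts[of "1 - \<epsilon>" \<delta> "Suc m"] assms by auto
  show ?thesis
  proof (intro exI[of _ n] allI impI, elim conjE)
    fix I :: "nat set" assume I: "finite I" "n < card I"
    obtain C where C: "C \<subseteq> two_pow I" and
      dev: "\<And>X. X \<subseteq> two_pow I \<Longrightarrow> card X \<le> Suc m \<Longrightarrow>
        \<bar>real (card (inter_translates I C X)) / 2 ^ card I - (1 - \<epsilon>) ^ card X\<bar> < \<delta>"
      using n[OF I] by blast
    \<comment> \<open>For \<open>X = {?z}\<close> with the zero element \<open>?z\<close>, the
      intersection is \<open>C\<close> itself, so the deviation bound becomes the required bound on
      the density of \<open>C\<close>.\<close>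
    let ?z = "\<lambda>i\<in>I. 0 :: bit"
    have z: "?z \<in> two_pow I" by (simp add: two_pow_def)
    have "cadd I x ?z = x" if "x \<in> two_pow I" for x
      using that by (intro two_pow_eqI[OF cadd_in_two_pow that]) (simp add: cadd_def)
    then have "inter_translates I C {?z} = C"
      using C by (auto simp: inter_translates_eq)
    moreover have "\<bar>real (card (inter_translates I C {?z})) / 2 ^ card I - (1 - \<epsilon>) ^ card {?z}\<bar> < \<delta>"
      using z by (intro dev) auto
    ultimately have "\<bar>real (card C) / 2 ^ card I - (1 - \<epsilon>)\<bar> < \<delta>" by simp
    moreover have "real (card C) * 2 powi (- int (card I)) = real (card C) / 2 ^ card I"
      by (simp add: power_int_minus divide_inverse)
    ultimately show "\<exists>C \<subseteq> two_pow I.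
       1 - \<epsilon> + \<delta> \<ge> real (card C) * 2 powi (- int (card I)) \<and>
       real (card C) * 2 powi (- int (card I)) \<ge> 1 - \<epsilon> - \<delta> \<and>
       (\<forall>X \<subseteq> two_pow I. card X \<le> m \<longrightarrow>
          \<bar>real (card (inter_translates I C X)) / 2 ^ card I - (1 - \<epsilon>) ^ card X\<bar> < \<delta>)"
      using C dev by (intro exI[of _ C]) auto
  qed
qed

end
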